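(* Let $\mathcal{L}$ be a set, let $\pi_1$ and $\pi_2$ be equivalence relations on $\mathcal{L}$, and let $\pi_{12}$ be the equivalence relation generated by $\pi_1$ and $\pi_2$. For $M\in\mathcal{L}$ let $\mathcal{C}_1(M)$, $\mathcal{C}_2(M)$, $\mathcal{C}_{12}(M)$ denote the equivalence class of $M$ with respect to $\pi_1$, $\pi_2$, $\pi_{12}$, respectively. (a) Upon choosing any subset $\mathcal{D}$ of $\mathcal{L}$, let $\mathcal{B}:=\bigcup_{X\in\mathcal{D}}\mathcal{C}_{12}(X)$. Then the set $$\Pi_{\mathcal{B}}:=\{\mathcal{C}_1(M)\mid M\in\mathcal{B}\}\cup\{\mathcal{C}_2(M)\mid M\in\mathcal{L}\setminus\mathcal{B}\}$$ is a partition of $\mathcal{L}$, whose associated equivalence relation $\pi_{\mathcal{B}}$ is a blend of $\pi_1$ and $\pi_2$. (b) Conversely, any blend of $\pi_1$ and $\pi_2$ arises in the way described in (a) from at least one subset $\mathcal{D}$ of $\mathcal{L}$. (c) Let $\mathcal{D}$ and $\tilde{\mathcal{D}}$ be subsets of $\mathcal{L}$, and let $\pi_{\mathcal{B}}$ and $\pi_{\tilde{\mathcal{B}}}$ be the equivalence relations obtained by applying the construction from (a) to $\mathcal{D}$ and $\tilde{\mathcal{D}}$, respectively. Then $\pi_{\mathcal{B}}$ coincides with $\pi_{\tilde{\mathcal{B}}}$ if, and only if, $$\{\mathcal{C}_{12}(X)\mid X\in\mathcal{D}\setminus\mathcal{L}_{12}\}=\{\mathcal{C}_{12}(\tilde X)\mid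 \tilde X\in\tilde{\mathcal{D}}\setminus\mathcal{L}_{12}\},$$ where $\mathcal{L}_{12}:=\{M\in\mathcal{L}\mid \mathcal{C}_1(M)=\mathcal{C}_2(M)\}$.
   Context: For an equivalence relation $\pi_k$ on $\mathcal{L}$, $\Pi_k$ denotes the associated partition of $\mathcal{L}$ (the set of its equivalence classes). Given (not necessarily distinct) equivalence relations $\pi_1,\pi_2$ on $\mathcal{L}$, an equivalence relation $\pi_3$ on $\mathcal{L}$ is called a blend of $\pi_1$ and $\pi_2$ if $\Pi_3\subseteq\Pi_1\cup\Pi_2$, i.e. every $\pi_3$-class is a $\pi_1$-class or a $\pi_2$-class. The equivalence relation generated by $\pi_1$ and $\pi_2$ is the intersection of all equivalence relations on $\mathcal{L}$ that contain $\pi_1\cup\pi_2$. *)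

theory Defs
  imports Main "HOL-Library.Disjoint_Sets"
begin

text \<open>The family that is intersected contains \<^term>\<open>L \<times> L\<close> whenever
  \<^term>\<open>p\<close> and \<^term>\<open>q\<close> are relations on \<^term>\<open>L\<close>, so it is nonempty
  for equivalence relations on \<^term>\<open>L\<close>.\<close>

definition generated_equiv :: "'a set \<Rightarrow> 'a rel \<Rightarrow> 'a rel \<Rightarrow> 'a rel" where
  "generated_equiv L p q = \<Inter>{r. equiv L r \<and> p \<union> q \<subseteq> r}"

definition is_blend :: "'a set \<Rightarrow> 'a rel \<Rightarrow> 'a rel \<Rightarrow> 'a rel \<Rightarrow> bool" where
  "is_blend L p q r \<longleftrightarrow> equiv L r \<and> L // r \<subseteq> L // p \<union> L // q"

definition rel_of_partition :: "'a set set \<Rightarrow> 'a rel" where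
  "rel_of_partition P = {(x, y). \<exists>c \<in> P. x \<in> c \<and> y \<in> c}"

definition generated_saturation :: "'a set \<Rightarrow> 'a rel \<Rightarrow> 'a rel \<Rightarrow> 'a set \<Rightarrow> 'a set" where
  "generated_saturation L p q D = (\<Union>X\<in>D. generated_equiv L p q `` {X})"

definition blend_partition :: "'a set \<Rightarrow> 'a rel \<Rightarrow> 'a rel \<Rightarrow> 'a set \<Rightarrow> 'a set set" where
  "blend_partition L p q B = {p `` {M} | M. M \<in> B} \<union> {q `` {M} | M. M \<in> L - B}"

definition same_class_set :: "'a set \<Rightarrow> 'a rel \<Rightarrow> 'a rel \<Rightarrow> 'a set" where
  "same_class_set L p q = {M \<in> L. p `` {M} = q `` {M}}"

end

theory Submission
  imports Defs
begin

text \<open>Everything rests on one observation: a subset of \<^term>\<open>L\<close> is a union of \<open>\<pi>12\<close>-classes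
  exactly when it is closed under both \<open>\<pi>1\<close> and \<open>\<pi>2\<close> (\<open>generated_saturation_closed\<close>,
  \<open>generated_saturation_of_closed\<close>). Hence the sets \<open>B\<close> of the construction are precisely those for
  which no class of \<open>\<pi>1\<close> or \<open>\<pi>2\<close> straddles the boundary between \<open>B\<close> and its complement. One may
  therefore cut along that boundary and use the \<open>\<pi>1\<close>-classes inside and the \<open>\<pi>2\<close>-classes outside;
  this is (a), carried by \<open>partition_on_blend_partition\<close>.

  For (b), given a blend \<open>\<pi>3\<close>, let \<open>D\<close> consist of the points whose \<open>\<pi>3\<close>-class equals their
  \<open>\<pi>1\<close>-class. Clearly no \<open>\<pi>1\<close>-step leaves \<open>D\<close>. A \<open>\<pi>2\<close>-step cannot leave \<open>D\<close> either, because
  outside \<open>D\<close> the \<open>\<pi>3\<close>-classes are \<open>\<pi>2\<close>-classes, so that such a step would stay within one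
  \<open>\<pi>3\<close>-class (\<open>blend_agreement_set_closed\<close>). Thus \<open>D\<close> is its own saturation, and it reproduces
  \<open>\<pi>3\<close> class by class.

  For (c), the blend does not see whether a point with equal \<open>\<pi>1\<close>- and \<open>\<pi>2\<close>-class lies in \<open>B\<close>, but
  it determines membership in \<open>B\<close> of every other point. So two blends coincide exactly when their
  sets \<open>B\<close> agree off the set \<open>E\<close> of points with equal classes (\<open>blends_eq_iff\<close>). Since \<open>E\<close> is
  itself closed under both relations, it is a union of \<open>\<pi>12\<close>-classes, and removing it from \<open>B\<close>
  amounts to discarding the members of \<open>D\<close> that lie in it (\<open>saturation_diff_eq_iff\<close>).\<close>

section \<open>Generated equivalence relations and closed sets\<close>

lemma quotient_class_eq:
  assumes "equiv L r" "c \<in> L // r" "x \<in> c"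
  shows "r `` {x} = c"
  using assms(2,3) equiv_class_eq[OF assms(1)] by (blast elim: quotientE)

lemma equiv_generated_equiv:
  assumes "equiv L p" "equiv L q"
  shows "equiv L (generated_equiv L p q)"
proof (rule equivI)
  have "equiv L (L \<times> L)"
    by (auto intro!: equivI refl_onI symI transI)
  moreover have "p \<union> q \<subseteq> L \<times> L"
    using assms by (auto dest!: equiv_type)
  ultimately show "generated_equiv L p q \<subseteq> L \<times> L"
    unfolding generated_equiv_def by blast
  show "refl_on L (generated_equiv L p q)"
    unfolding generated_equiv_def by (auto intro!: refl_onI elim!: equivE dest: refl_onD)
  show "sym (generated_equiv L p q)"
    unfolding generated_equiv_def using equivE by (intro sym_INTER[of _ id, simplified]) blast
  show "trans (generated_equiv L p q)"
    unfolding generated_equiv_def using equivE by (intro trans_INTER[of _ id, simplified]) blast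
qed

lemma generated_equiv_superset: "p \<union> q \<subseteq> generated_equiv L p q"
  unfolding generated_equiv_def by blast

definition closed_under :: "'a set \<Rightarrow> 'a rel \<Rightarrow> 'a rel \<Rightarrow> 'a set \<Rightarrow> bool" where
  "closed_under L p q B \<longleftrightarrow> B \<subseteq> L \<and> p `` B \<subseteq> B \<and> q `` B \<subseteq> B"

text \<open>A closed set separates no two related points: the relation ``both points lie in \<open>B\<close> or
  neither does'' on \<open>L\<close> is an equivalence relation containing \<open>p\<close> and \<open>q\<close>, hence contains the
  generated one. This avoids describing the generated relation by chains of alternating steps.\<close>

lemma generated_equiv_closed:
  assumes "equiv L p" "equiv L q" "closed_under L p q B" "(x, y) \<in> generated_equiv L p q"
  shows "x \<in> B \<longleftrightarrow> y \<in> B"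
proof -
  define s where "s = {(x, y) \<in> L \<times> L. x \<in> B \<longleftrightarrow> y \<in> B}"
  have sym: "sym p" "sym q"
    using assms(1,2) by (auto elim: equivE)
  have "equiv L s"
    unfolding s_def by (auto intro!: equivI refl_onI symI transI)
  moreover have "p \<subseteq> s" "q \<subseteq> s"
    using assms(3) equiv_type[OF assms(1)] equiv_type[OF assms(2)]
      sym(1)[THEN symD] sym(2)[THEN symD]
    unfolding s_def closed_under_def by blast+
  ultimately have "generated_equiv L p q \<subseteq> s"
    unfolding generated_equiv_def by blast
  then show ?thesis
    using assms(4) unfolding s_def by blast
qed

lemma generated_saturation_closed:
  assumes "equiv L p" "equiv L q"
  shows "closed_under L p q (generated_saturation L p q D)"
proof -
  let ?g = "generated_equiv L p q"
  have "?g \<subseteq> L \<times> L" "trans ?g"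
    using equiv_generated_equiv[OF assms] by (auto elim: equivE)
  then show ?thesis
    using generated_equiv_superset[of p q L]
    unfolding closed_under_def generated_saturation_def
    by (blast dest: transD)
qed

lemma generated_saturation_of_closed:
  assumes "equiv L p" "equiv L q" "closed_under L p q D"
  shows "generated_saturation L p q D = D"
proof
  show "generated_saturation L p q D \<subseteq> D"
    unfolding generated_saturation_def using generated_equiv_closed[OF assms] by blast
  show "D \<subseteq> generated_saturation L p q D"
    using assms(3) equiv_class_self[OF equiv_generated_equiv[OF assms(1,2)]]
    unfolding generated_saturation_def closed_under_def by fast
qed

section \<open>Blends built from closed sets\<close>

text \<open>Classes of the same relation are disjoint or equal. A \<open>p\<close>-class and a \<open>q\<close>-class that both
  occur are disjoint because the first stays in \<open>B\<close> and the second stays outside.\<close>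

lemma partition_on_blend_partition:
  assumes "equiv L p" "equiv L q" "closed_under L p q B"
  shows "partition_on L (blend_partition L p q B)"
proof -
  have B: "B \<subseteq> L"
    using assms(3) by (simp add: closed_under_def)
  have p_in: "p `` {M} \<subseteq> B" if "M \<in> B" for M
    using that assms(3) unfolding closed_under_def by blast
  \<comment> \<open>By symmetry the complement of a closed set is closed as well.\<close>
  have q_out: "q `` {M} \<subseteq> L - B" if "M \<in> L - B" for M
    using that assms(2,3) unfolding closed_under_def
    by (blast elim!: equivE dest: symD)
  show ?thesis
  proof (rule partition_onI)
    show "\<Union> (blend_partition L p q B) = L"
    proof
      show "\<Union> (blend_partition L p q B) \<subseteq> L"
        unfolding blend_partition_def using p_in q_out B by blast
      show "L \<subseteq> \<Union> (blend_partition L p q B)"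
      proof
        fix M assume "M \<in> L"
        then have "M \<in> p `` {M}" "M \<in> q `` {M}"
          by (rule equiv_class_self[OF assms(1)] equiv_class_self[OF assms(2)])+
        then show "M \<in> \<Union> (blend_partition L p q B)"
          using \<open>M \<in> L\<close> unfolding blend_partition_def by (cases "M \<in> B") blast+
      qed
    qed
    show "{} \<notin> blend_partition L p q B"
      using B equiv_class_self[OF assms(1)] equiv_class_self[OF assms(2)]
      unfolding blend_partition_def by blast
    show "disjnt c d"
      if cd: "c \<in> blend_partition L p q B" "d \<in> blend_partition L p q B" "c \<noteq> d" for c d
    proof -
      have same: "disjnt (r `` {M}) (r `` {N})"
        if "equiv L r" "M \<in> L" "N \<in> L" "r `` {M} \<noteq> r `` {N}" for r M N
        using quotient_disj[OF that(1) quotientI[OF that(2)] quotientI[OF that(3)]] that(4)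
        by (simp add: disjnt_def)
      have mixed: "disjnt (p `` {M}) (q `` {N})" if "M \<in> B" "N \<in> L - B" for M N
        using p_in[OF that(1)] q_out[OF that(2)] by (auto simp: disjnt_def)
      obtain M where M: "(M \<in> B \<and> c = p `` {M}) \<or> (M \<in> L - B \<and> c = q `` {M})"
        using cd(1) unfolding blend_partition_def by blast
      obtain N where N: "(N \<in> B \<and> d = p `` {N}) \<or> (N \<in> L - B \<and> d = q `` {N})"
        using cd(2) unfolding blend_partition_def by blast
      show ?thesis
        using M N
      proof (elim disjE conjE)
        assume "M \<in> B" "c = p `` {M}" "N \<in> B" "d = p `` {N}"
        then show ?thesis
          using same[OF assms(1)] cd(3) B by blast
      next
        assume "M \<in> L - B" "c = q `` {M}" "N \<in> L - B" "d = q `` {N}"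
        then show ?thesis
          using same[OF assms(2)] cd(3) by blast
      qed (auto intro: mixed disjnt_sym[OF mixed])
    qed
  qed
qed

lemma
  assumes "partition_on L P"
  shows equiv_rel_of_partition: "equiv L (rel_of_partition P)"
    and quotient_rel_of_partition: "L // rel_of_partition P = P"
  using equiv_partition_on[OF assms] partition_on_eq_quotient[OF assms]
  by (simp_all add: rel_of_partition_def)

lemma is_blend_rel_of_blend_partition:
  assumes "equiv L p" "equiv L q" "closed_under L p q B"
  shows "is_blend L p q (rel_of_partition (blend_partition L p q B))"
proof -
  have "blend_partition L p q B \<subseteq> L // p \<union> L // q"
    using assms(3) unfolding blend_partition_def closed_under_def
    by (auto intro: quotientI)
  then show ?thesis
    using partition_on_blend_partition[OF assms]
    by (simp add: is_blend_def equiv_rel_of_partition quotient_rel_of_partition)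
qed

lemma equiv_eqI_classes:
  assumes "equiv L r" "equiv L s" "\<And>M. M \<in> L \<Longrightarrow> r `` {M} = s `` {M}"
  shows "r = s"
proof -
  have "(x, y) \<in> r \<longleftrightarrow> (x, y) \<in> s" for x y
  proof (cases "x \<in> L")
    case True
    then show ?thesis
      using assms(3)[OF True] by blast
  next
    case False
    then show ?thesis
      using equiv_type[OF assms(1)] equiv_type[OF assms(2)] by blast
  qed
  then show ?thesis
    by auto
qed

text \<open>The class of \<open>M\<close> is the only block containing \<open>M\<close>, and the block named on the right contains
  it. Parts (b) and (c) compare equivalence relations class by class by means of this formula.\<close>

lemma class_of_blend:
  assumes "equiv L p" "equiv L q" "closed_under L p q B" "M \<in> L"
  shows "rel_of_partition (blend_partition L p q B) `` {M} =
    (if M \<in> B then p `` {M} else q `` {M})" (is "?r `` {M} = ?c")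
proof -
  note part = partition_on_blend_partition[OF assms(1-3)]
  have "?c \<in> L // ?r"
    using assms(4) unfolding quotient_rel_of_partition[OF part] unfolding blend_partition_def
    by auto
  moreover have "M \<in> ?c"
    using equiv_class_self[OF assms(1,4)] equiv_class_self[OF assms(2,4)] by simp
  ultimately show ?thesis
    using equiv_rel_of_partition[OF part] by (intro quotient_class_eq)
qed

section \<open>Every blend comes from a closed set\<close>

text \<open>The \<open>r\<close>-class of \<open>M\<close> is a \<open>p\<close>-class or a \<open>q\<close>-class of some point; as it contains \<open>M\<close>, that
  point may be taken to be \<open>M\<close>.\<close>

lemma blend_class_cases:
  assumes "equiv L p" "equiv L q" "is_blend L p q r" "M \<in> L"
  shows "r `` {M} = p `` {M} \<or> r `` {M} = q `` {M}"
proof -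
  have "M \<in> r `` {M}"
    using assms(3,4) equiv_class_self unfolding is_blend_def by fast
  moreover have "r `` {M} \<in> L // p \<union> L // q"
    using assms(3) quotientI[OF assms(4)] unfolding is_blend_def by blast
  ultimately show ?thesis
    using quotient_class_eq[OF assms(1)] quotient_class_eq[OF assms(2)] by blast
qed

text \<open>This set is the witness for (b). A \<open>q\<close>-step from it to a point \<open>N\<close> outside would lie in the
  \<open>r\<close>-class of \<open>N\<close>, which is a \<open>q\<close>-class; but then the \<open>r\<close>-class, and with it the \<open>p\<close>-class, of the
  starting point would contain \<open>N\<close>.\<close>

lemma blend_agreement_set_closed:
  assumes "equiv L p" "equiv L q" "is_blend L p q r"
  shows "closed_under L p q {M \<in> L. r `` {M} = p `` {M}}" (is "closed_under L p q ?D")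
proof -
  have r: "equiv L r"
    using assms(3) by (simp add: is_blend_def)
  \<comment> \<open>An \<open>r\<close>-step from \<open>?D\<close> is also a \<open>p\<close>-step, so it changes neither of the two classes.\<close>
  have step: "N \<in> ?D" if "M \<in> ?D" "(M, N) \<in> r" for M N
  proof -
    have "(M, N) \<in> p"
      using that by blast
    then have "p `` {N} = p `` {M}" "r `` {N} = r `` {M}" "N \<in> L"
      using that(2) equiv_class_eq[OF assms(1)] equiv_class_eq[OF r] equiv_type[OF r] by auto
    then show ?thesis
      using that(1) by simp
  qed
  have "N \<in> ?D" if "M \<in> ?D" "(M, N) \<in> p" for M N
    using step[OF that(1)] that by blast
  moreover have "N \<in> ?D" if M: "M \<in> ?D" and MN: "(M, N) \<in> q" for M N
  proof (rule ccontr)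
    assume "N \<notin> ?D"
    moreover have "N \<in> L"
      using MN equiv_type[OF assms(2)] by blast
    ultimately have "r `` {N} = q `` {N}"
      using blend_class_cases[OF assms] by blast
    moreover have "(N, M) \<in> q"
      using MN assms(2) by (auto elim!: equivE dest: symD)
    ultimately have "(M, N) \<in> r"
      using r by (auto elim!: equivE dest: symD)
    then show False
      using step[OF M] \<open>N \<notin> ?D\<close> by blast
  qed
  ultimately show ?thesis
    unfolding closed_under_def by blast
qed

lemma blend_arises_from_subset:
  assumes "equiv L p" "equiv L q" "is_blend L p q r"
  shows "\<exists>D \<subseteq> L. r = rel_of_partition (blend_partition L p q (generated_saturation L p q D))"
proof -
  define D where "D = {M \<in> L. r `` {M} = p `` {M}}"
  have D: "closed_under L p q D"
    unfolding D_def using assms by (rule blend_agreement_set_closed)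
  have "r = rel_of_partition (blend_partition L p q D)"
  proof (rule equiv_eqI_classes)
    show "equiv L r"
      using assms(3) by (simp add: is_blend_def)
    show "equiv L (rel_of_partition (blend_partition L p q D))"
      using assms(1,2) D by (intro equiv_rel_of_partition partition_on_blend_partition)
    show "r `` {M} = rel_of_partition (blend_partition L p q D) `` {M}" if "M \<in> L" for M
    proof (cases "M \<in> D")
      case True
      then have "r `` {M} = p `` {M}"
        unfolding D_def by blast
      then show ?thesis
        unfolding class_of_blend[OF assms(1,2) D that] using True by simp
    next
      case False
      then have "r `` {M} = q `` {M}"
        using blend_class_cases[OF assms that] that unfolding D_def by blast
      then show ?thesis
        unfolding class_of_blend[OF assms(1,2) D that] using False by simp
    qed
  qed
  then show ?thesis
    using generated_saturation_of_closed[OF assms(1,2) D] D unfolding closed_under_def by metis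
qed

section \<open>When two closed sets give the same blend\<close>

lemma blends_eq_iff:
  assumes "equiv L p" "equiv L q" "closed_under L p q B" "closed_under L p q B'"
  shows "rel_of_partition (blend_partition L p q B) = rel_of_partition (blend_partition L p q B')
    \<longleftrightarrow> B - same_class_set L p q = B' - same_class_set L p q" (is "?r = ?r' \<longleftrightarrow> _")
proof -
  have "?r = ?r' \<longleftrightarrow> (\<forall>M \<in> L. ?r `` {M} = ?r' `` {M})"
  proof
    assume "\<forall>M \<in> L. ?r `` {M} = ?r' `` {M}"
    then show "?r = ?r'"
      using equiv_rel_of_partition[OF partition_on_blend_partition[OF assms(1-3)]]
        equiv_rel_of_partition[OF partition_on_blend_partition[OF assms(1,2,4)]]
      by (intro equiv_eqI_classes[of L]) blast+
  qed simp
  also have "\<dots> \<longleftrightarrow> (\<forall>M \<in> L. p `` {M} = q `` {M} \<or> (M \<in> B \<longleftrightarrow> M \<in> B'))"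
    by (intro ball_cong refl)
      (auto simp: class_of_blend[OF assms(1-3)] class_of_blend[OF assms(1,2,4)])
  also have "\<dots> \<longleftrightarrow> B - same_class_set L p q = B' - same_class_set L p q"
    using assms(3,4) unfolding closed_under_def same_class_set_def by blast
  finally show ?thesis .
qed

lemma same_class_set_closed:
  assumes "equiv L p" "equiv L q"
  shows "closed_under L p q (same_class_set L p q)"
proof -
  have "N \<in> same_class_set L p q"
    if "M \<in> same_class_set L p q" "(M, N) \<in> p \<union> q" for M N
  proof -
    \<comment> \<open>Since the two classes of \<open>M\<close> agree, a step of either relation is a step of both.\<close>
    have "(M, N) \<in> p" "(M, N) \<in> q" "p `` {M} = q `` {M}"
      using that unfolding same_class_set_def by blast+
    then show ?thesis
      using equiv_class_eq[OF assms(1)] equiv_class_eq[OF assms(2)] equiv_type[OF assms(1)]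
      unfolding same_class_set_def by blast
  qed
  then show ?thesis
    unfolding closed_under_def same_class_set_def by blast
qed

text \<open>A closed set \<open>S\<close> contains a generated class or misses it. So deleting \<open>S\<close> from the saturation
  leaves the union of the classes of the points of \<open>D\<close> outside \<open>S\<close>, and a union of classes determines
  which classes occur in it.\<close>

lemma saturation_diff_eq_iff:
  assumes "equiv L p" "equiv L q" "closed_under L p q S" "D \<subseteq> L" "D' \<subseteq> L"
  shows "generated_saturation L p q D - S = generated_saturation L p q D' - S \<longleftrightarrow>
    {generated_equiv L p q `` {X} | X. X \<in> D - S} =
    {generated_equiv L p q `` {X} | X. X \<in> D' - S}"
proof -
  let ?g = "generated_equiv L p q"
  let ?K = "\<lambda>D. {?g `` {X} | X. X \<in> D - S}"
  have g: "equiv L ?g"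
    using assms(1,2) by (rule equiv_generated_equiv)
  note S = generated_equiv_closed[OF assms(1-3)]
  have union: "generated_saturation L p q D - S = \<Union> (?K D)" for D
    unfolding generated_saturation_def using S by blast
  have classes: "?K D = {?g `` {X} | X. X \<in> generated_saturation L p q D - S}" if "D \<subseteq> L" for D
  proof
    show "?K D \<subseteq> {?g `` {X} | X. X \<in> generated_saturation L p q D - S}"
      using that equiv_class_self[OF g] unfolding generated_saturation_def by blast
    show "{?g `` {X} | X. X \<in> generated_saturation L p q D - S} \<subseteq> ?K D"
      unfolding generated_saturation_def using S equiv_class_eq[OF g] by blast
  qed
  show ?thesis
  proof
    assume "generated_saturation L p q D - S = generated_saturation L p q D' - S"
    then show "?K D = ?K D'"
      by (simp only: classes[OF assms(4)] classes[OF assms(5)])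
  next
    assume "?K D = ?K D'"
    then show "generated_saturation L p q D - S = generated_saturation L p q D' - S"
      by (simp only: union)
  qed
qed

theorem proposition2p4:
  fixes L :: "'a set" and \<pi>1 \<pi>2 :: "'a rel"
  assumes "equiv L \<pi>1" and "equiv L \<pi>2"
  shows
    "(\<forall>D. D \<subseteq> L \<longrightarrow>
        (let \<Pi>B = blend_partition L \<pi>1 \<pi>2 (generated_saturation L \<pi>1 \<pi>2 D)
         in partition_on L \<Pi>B \<and> is_blend L \<pi>1 \<pi>2 (rel_of_partition \<Pi>B))) \<and>
     (\<forall>\<pi>3. is_blend L \<pi>1 \<pi>2 \<pi>3 \<longrightarrow>
        (\<exists>D. D \<subseteq> L \<and>
          \<pi>3 = rel_of_partition
                 (blend_partition L \<pi>1 \<pi>2 (generated_saturation L \<pi>1 \<pi>2 D)))) \<and>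
     (\<forall>D D'. D \<subseteq> L \<longrightarrow> D' \<subseteq> L \<longrightarrow>
        (rel_of_partition (blend_partition L \<pi>1 \<pi>2 (generated_saturation L \<pi>1 \<pi>2 D)) =
         rel_of_partition (blend_partition L \<pi>1 \<pi>2 (generated_saturation L \<pi>1 \<pi>2 D'))
         \<longleftrightarrow>
         {generated_equiv L \<pi>1 \<pi>2 `` {X} | X. X \<in> D - same_class_set L \<pi>1 \<pi>2} =
         {generated_equiv L \<pi>1 \<pi>2 `` {X} | X. X \<in> D' - same_class_set L \<pi>1 \<pi>2}))"
proof (intro conjI allI impI)
  note eq = assms
  note closed = generated_saturation_closed[OF eq]
  show "let \<Pi>B = blend_partition L \<pi>1 \<pi>2 (generated_saturation L \<pi>1 \<pi>2 D)
         in partition_on L \<Pi>B \<and> is_blend L \<pi>1 \<pi>2 (rel_of_partition \<Pi>B)" for D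
    using partition_on_blend_partition[OF eq closed] is_blend_rel_of_blend_partition[OF eq closed]
    by (simp add: Let_def)
  show "\<exists>D. D \<subseteq> L \<and> \<pi>3 = rel_of_partition
          (blend_partition L \<pi>1 \<pi>2 (generated_saturation L \<pi>1 \<pi>2 D))"
    if "is_blend L \<pi>1 \<pi>2 \<pi>3" for \<pi>3
    using blend_arises_from_subset[OF eq that] by blast
  show "rel_of_partition (blend_partition L \<pi>1 \<pi>2 (generated_saturation L \<pi>1 \<pi>2 D)) =
         rel_of_partition (blend_partition L \<pi>1 \<pi>2 (generated_saturation L \<pi>1 \<pi>2 D'))
         \<longleftrightarrow>
         {generated_equiv L \<pi>1 \<pi>2 `` {X} | X. X \<in> D - same_class_set L \<pi>1 \<pi>2} =
         {generated_equiv L \<pi>1 \<pi>2 `` {X} | X. X \<in> D' - same_class_set L \<pi>1 \<pi>2}"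
    if "D \<subseteq> L" "D' \<subseteq> L" for D D'
    using blends_eq_iff[OF eq closed closed]
      saturation_diff_eq_iff[OF eq same_class_set_closed[OF eq] that] by simp
qed

end
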